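(* Let $G$ be a finite, simple, connected graph with $m$ edges and $n\ge4$ vertices. Then $\sigma^-(G)\le\lfloor m/2+n/4\rfloor$, with equality if and only if $G$ is $K_n$, $K_n-e$, or $K_n-\triangle$.
   Context: A parity-signature of $G$ is a map $\sigma:E(G)\to\{1,-1\}$ for which there is a partition $V(G)=V_1\cup V_2$ with $||V_1|-|V_2||\le1$ such that an edge has sign $-1$ (is negative) exactly when its ends lie in different sets. $\sigma^-(G)$ (the $rna$ number) is the minimum number of negative edges over all parity-signatures of $G$; equivalently, the minimum of the number of edges between $V_1$ and $V_2$ over such partitions. $K_n-e$ is $K_n$ minus one edge and $K_n-\triangle$ is $K_n$ minus the three edges of a triangle. *)

theory Defs
  imports Complex_Main
begin

definition complete_edges :: "'a set \<Rightarrow> 'a set set" where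
  "complete_edges V = {{u, v} | u v. u \<in> V \<and> v \<in> V \<and> u \<noteq> v}"

definition finite_simple_graph :: "'a set \<Rightarrow> 'a set set \<Rightarrow> bool" where
  "finite_simple_graph V E \<longleftrightarrow> finite V \<and> E \<subseteq> complete_edges V"

definition connected_graph :: "'a set \<Rightarrow> 'a set set \<Rightarrow> bool" where
  "connected_graph V E \<longleftrightarrow>
     V \<noteq> {} \<and> (\<forall>u\<in>V. \<forall>v\<in>V. (u, v) \<in> {(x, y). {x, y} \<in> E}\<^sup>*)"

(* Values of \<sigma> outside E are irrelevant: only the edges in E are constrained or counted. *)
definition parity_signature :: "'a set \<Rightarrow> 'a set set \<Rightarrow> ('a set \<Rightarrow> int) \<Rightarrow> bool" where
  "parity_signature V E \<sigma> \<longleftrightarrow>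
     (\<forall>e\<in>E. \<sigma> e \<in> {1, -1}) \<and>
     (\<exists>V1 V2. V1 \<union> V2 = V \<and> V1 \<inter> V2 = {} \<and> \<bar>int (card V1) - int (card V2)\<bar> \<le> 1 \<and>
        (\<forall>e\<in>E. \<sigma> e = -1 \<longleftrightarrow> (\<exists>u\<in>V1. \<exists>v\<in>V2. e = {u, v})))"

definition negative_edges :: "'a set set \<Rightarrow> ('a set \<Rightarrow> int) \<Rightarrow> 'a set set" where
  "negative_edges E \<sigma> = {e \<in> E. \<sigma> e = -1}"

definition rna_number :: "'a set \<Rightarrow> 'a set set \<Rightarrow> nat" where
  "rna_number V E = (LEAST k. \<exists>\<sigma>. parity_signature V E \<sigma> \<and> card (negative_edges E \<sigma>) = k)"

(* A graph on V is isomorphic to K_n, K_n - e or K_n - triangle, n = card V, exactly when it is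
   the complete graph on V itself, possibly with one edge or the edges of one triangle removed. *)
definition is_complete :: "'a set \<Rightarrow> 'a set set \<Rightarrow> bool" where
  "is_complete V E \<longleftrightarrow> E = complete_edges V"

definition is_complete_minus_edge :: "'a set \<Rightarrow> 'a set set \<Rightarrow> bool" where
  "is_complete_minus_edge V E \<longleftrightarrow> (\<exists>e\<in>complete_edges V. E = complete_edges V - {e})"

definition is_complete_minus_triangle :: "'a set \<Rightarrow> 'a set set \<Rightarrow> bool" where
  "is_complete_minus_triangle V E \<longleftrightarrow>
     (\<exists>a\<in>V. \<exists>b\<in>V. \<exists>c\<in>V. a \<noteq> b \<and> b \<noteq> c \<and> a \<noteq> c \<and>
        E = complete_edges V - {{a, b}, {b, c}, {a, c}})"

end

theory Submission imports Defs begin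

text \<open>
  Let \<open>H\<close> be the complement of the graph, with \<open>e\<close> edges. A bisection cuts \<open>\<lfloor>n\<^sup>2/4\<rfloor>\<close> edges of
  \<open>K\<^sub>n\<close>, so the theorem says that \<open>H\<close> has a bisection cutting at least \<open>\<lceil>e/2\<rceil>\<close> of its edges, and
  that this is optimal only if \<open>H\<close> has at most one edge or is a triangle. Extend a matching of \<open>H\<close>
  of size \<open>\<mu>\<close> to a pairing of the vertices and separate each pair one after the other in the better
  of the two ways: this cuts at least \<open>(e + \<mu>)/2\<close> edges of \<open>H\<close>. It exceeds \<open>\<lceil>e/2\<rceil>\<close> if \<open>e > 0\<close> is
  even, or if \<open>e\<close> is odd and \<open>\<mu> \<ge> 2\<close>. Otherwise any two edges of \<open>H\<close> meet, so \<open>H\<close> is a triangle or a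
  star. The centre of a star has a neighbour in the connected graph, hence \<open>e \<le> n - 2\<close>, and one can
  put enough leaves opposite to the centre.
\<close>

definition bisection :: "'a set \<Rightarrow> 'a set \<Rightarrow> 'a set \<Rightarrow> bool" where
  "bisection V A B \<longleftrightarrow> A \<union> B = V \<and> A \<inter> B = {} \<and> \<bar>int (card A) - int (card B)\<bar> \<le> 1"

definition cut :: "'a set set \<Rightarrow> 'a set \<Rightarrow> 'a set \<Rightarrow> 'a set set" where
  "cut F A B = {e \<in> F. \<exists>u\<in>A. \<exists>v\<in>B. e = {u, v}}"

lemma cut_subset: "cut F A B \<subseteq> F"
  by (auto simp: cut_def)

lemma cut_Un: "cut (F \<union> G) A B = cut F A B \<union> cut G A B"
  by (auto simp: cut_def)

lemma cut_mono: "A \<subseteq> A' \<Longrightarrow> B \<subseteq> B' \<Longrightarrow> cut F A B \<subseteq> cut F A' B'"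
  by (auto simp: cut_def)

lemma complete_edges_iff: "{u, v} \<in> complete_edges V \<longleftrightarrow> u \<in> V \<and> v \<in> V \<and> u \<noteq> v"
  by (auto simp: complete_edges_def doubleton_eq_iff)

lemma complete_edges_eq: "complete_edges V = {e. e \<subseteq> V \<and> card e = 2}"
  by (auto simp: complete_edges_def card_2_iff)

lemma finite_complete_edges: "finite V \<Longrightarrow> finite (complete_edges V)"
  by (simp add: complete_edges_eq)

lemma card_complete_edges: "finite V \<Longrightarrow> 2 * card (complete_edges V) = card V * (card V - 1)"
  by (simp add: complete_edges_eq n_subsets choose_two) (cases "card V", auto)

lemma card_cut_complete_edges:
  assumes "bisection V A B" "finite V"
  shows "card (cut (complete_edges V) A B) = (card V)\<^sup>2 div 4"
proof -
  have V: "A \<union> B = V" and dis: "A \<inter> B = {}" and bal: "\<bar>int (card A) - int (card B)\<bar> \<le> 1"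
    using assms by (auto simp: bisection_def)
  have fin: "finite A" "finite B" using V assms(2) by auto
  have "cut (complete_edges V) A B = (\<lambda>(u, v). {u, v}) ` (A \<times> B)"
    using V dis by (auto simp: cut_def complete_edges_iff)
  moreover have "inj_on (\<lambda>(u, v). {u, v}) (A \<times> B)"
    using dis by (auto simp: inj_on_def doubleton_eq_iff)
  ultimately have c: "card (cut (complete_edges V) A B) = card A * card B"
    by (simp add: card_image card_cartesian_product)
  have "card V = card A + card B" using V dis fin card_Un_disjoint by metis
  moreover have "card A = card B \<or> card A = card B + 1 \<or> card B = card A + 1"
    using bal by linarith
  ultimately have "(card V)\<^sup>2 = 4 * (card A * card B) \<or> (card V)\<^sup>2 = 4 * (card A * card B) + 1"
    by (auto simp: power2_eq_square algebra_simps)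
  then show ?thesis using c by auto
qed

lemma card_cut_complement:
  assumes "bisection V A B" "finite V" "E \<subseteq> complete_edges V"
  shows "card (cut E A B) + card (cut (complete_edges V - E) A B) = (card V)\<^sup>2 div 4"
proof -
  have "cut (complete_edges V) A B = cut E A B \<union> cut (complete_edges V - E) A B"
    using assms(3) by (auto simp: cut_def)
  moreover have "cut E A B \<inter> cut (complete_edges V - E) A B = {}" by (auto simp: cut_def)
  moreover have "finite (cut E A B)" "finite (cut (complete_edges V - E) A B)"
    using finite_complete_edges[OF assms(2)] assms(3)
    by (meson cut_subset finite_subset Diff_subset)+
  ultimately show ?thesis
    using card_cut_complete_edges[OF assms(1,2)] card_Un_disjoint by metis
qed

lemma bisection_exists:
  assumes "finite V"
  obtains A B where "bisection V A B"
proof -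
  obtain B where B: "B \<subseteq> V" "card B = card V div 2"
    using obtain_subset_with_card_n[of "card V div 2" V] by auto
  have "card (V - B) = card V - card V div 2"
    using B assms by (simp add: card_Diff_subset finite_subset)
  then have "bisection V (V - B) B" using B by (auto simp: bisection_def)
  then show ?thesis by (rule that)
qed

lemma parity_signature_bisection:
  assumes "parity_signature V E \<sigma>"
  obtains A B where "bisection V A B" "negative_edges E \<sigma> = cut E A B"
  using assms unfolding parity_signature_def
proof (elim conjE exE)
  fix A B
  assume "A \<union> B = V" "A \<inter> B = {}" "\<bar>int (card A) - int (card B)\<bar> \<le> 1"
    and *: "\<forall>e\<in>E. \<sigma> e = -1 \<longleftrightarrow> (\<exists>u\<in>A. \<exists>v\<in>B. e = {u, v})"
  then have "bisection V A B" by (simp add: bisection_def)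
  moreover have "negative_edges E \<sigma> = cut E A B"
    unfolding negative_edges_def cut_def using * by (intro Collect_cong) (simp cong: conj_cong)
  ultimately show ?thesis by (rule that)
qed

lemma bisection_parity_signature:
  assumes "bisection V A B"
  obtains \<sigma> where "parity_signature V E \<sigma>" "negative_edges E \<sigma> = cut E A B"
proof -
  define \<sigma> :: "'a set \<Rightarrow> int" where "\<sigma> = (\<lambda>e. if \<exists>u\<in>A. \<exists>v\<in>B. e = {u, v} then -1 else 1)"
  have "parity_signature V E \<sigma>"
    unfolding parity_signature_def
    by (intro conjI ballI exI[of _ A] exI[of _ B]) (use assms in \<open>auto simp: \<sigma>_def bisection_def\<close>)
  moreover have "negative_edges E \<sigma> = cut E A B"
    by (auto simp: negative_edges_def cut_def \<sigma>_def)
  ultimately show ?thesis by (rule that)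
qed

lemma rna_number_le_cut:
  assumes "bisection V A B"
  shows "rna_number V E \<le> card (cut E A B)"
proof -
  obtain \<sigma> where "parity_signature V E \<sigma>" "negative_edges E \<sigma> = cut E A B"
    using bisection_parity_signature[OF assms] .
  then show ?thesis unfolding rna_number_def by (intro Least_le) auto
qed

lemma rna_number_attained:
  assumes "finite V"
  obtains A B where "bisection V A B" "rna_number V E = card (cut E A B)"
proof -
  obtain A B where "bisection V A B" using bisection_exists[OF assms] .
  then obtain \<sigma> where "parity_signature V E \<sigma>" using bisection_parity_signature by metis
  then have "\<exists>k \<sigma>. parity_signature V E \<sigma> \<and> card (negative_edges E \<sigma>) = k" by blast
  from LeastI_ex[OF this] obtain \<tau>
    where \<tau>: "parity_signature V E \<tau>" "card (negative_edges E \<tau>) = rna_number V E"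
    unfolding rna_number_def by blast
  from \<tau>(1) obtain A B where "bisection V A B" "negative_edges E \<tau> = cut E A B"
    by (rule parity_signature_bisection)
  with \<tau>(2) show ?thesis by (intro that[of A B]) simp_all
qed

lemma bisection_insert_pair:
  assumes "bisection (V - {u, v}) A B" "finite V" "u \<in> V" "v \<in> V" "u \<noteq> v"
  shows "bisection V (insert u A) (insert v B)"
proof -
  have *: "A \<union> B = V - {u, v}" "A \<inter> B = {}" "\<bar>int (card A) - int (card B)\<bar> \<le> 1"
    using assms(1) by (auto simp: bisection_def)
  then have "finite A" "finite B" using assms(2) by (metis finite_Diff finite_Un)+
  moreover have "u \<notin> A" "v \<notin> B" using * by blast+
  ultimately show ?thesis using * assms(3-5) unfolding bisection_def by auto
qed

lemma bisection_cutting_matching: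
  assumes "finite V" "H \<subseteq> complete_edges V" "M \<subseteq> H" "pairwise disjnt M"
  shows "\<exists>A B. bisection V A B \<and> card H + card M \<le> 2 * card (cut H A B)"
  using assms
proof (induction "card V" arbitrary: V H M rule: less_induct)
  case less
  note finV = \<open>finite V\<close> and H = \<open>H \<subseteq> complete_edges V\<close>
  show ?case
  proof (cases "card V \<le> 1")
    case True
    have "e \<notin> H" for e
    proof
      assume "e \<in> H"
      then have "e \<subseteq> V" "card e = 2" using H by (auto simp: complete_edges_eq)
      then show False using card_mono[OF finV, of e] True by simp
    qed
    then have "H = {}" by blast
    then have "card H + card M = 0" using less.prems by auto
    moreover obtain A B where "bisection V A B" using bisection_exists[OF finV] .
    ultimately show ?thesis by auto
  next
    case False
    obtain u v where uv: "u \<in> V" "v \<in> V" "u \<noteq> v" "M \<noteq> {} \<longrightarrow> {u, v} \<in> M"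
    proof (cases "M = {}")
      case True
      obtain u where "u \<in> V" using False by fastforce
      moreover have "V \<noteq> {u}" using False by auto
      ultimately show ?thesis using that True by blast
    next
      case False
      then obtain e where "e \<in> M" by blast
      moreover from this have "e \<in> complete_edges V" using less.prems by auto
      ultimately show ?thesis using that unfolding complete_edges_def by blast
    qed
    define V' where "V' = V - {u, v}"
    define H' where "H' = {e \<in> H. u \<notin> e \<and> v \<notin> e}"
    define D where "D = H \<inter> {{u, v}}"
    define X where "X = H - H' - D"
    have finH: "finite H" using H finite_complete_edges[OF finV] finite_subset by blast
    have part: "H = H' \<union> X \<union> D" "H' \<inter> X = {}" "(H' \<union> X) \<inter> D = {}"
      by (auto simp: X_def H'_def D_def)
    have fin: "finite H'" "finite X" "finite D" using part(1) finH by (metis finite_Un)+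
    have cardH: "card H = card H' + card X + card D"
      using part fin by (metis card_Un_disjoint finite_Un)
    have M': "M - D \<subseteq> H'"
    proof
      fix e assume e: "e \<in> M - D"
      then have "{u, v} \<in> M" "e \<noteq> {u, v}" using uv less.prems(3) by (auto simp: D_def)
      then have "disjnt e {u, v}" using e pairwiseD[OF less.prems(4)] by blast
      then show "e \<in> H'" using e less.prems(3) by (auto simp: H'_def)
    qed
    have "M \<subseteq> (M - D) \<union> D" by blast
    moreover have "finite (M - D)" using M' fin(1) by (rule finite_subset)
    ultimately have "card M \<le> card (M - D) + card D"
      using fin(3) by (meson card_Un_le card_mono finite_UnI le_trans)
    have "card V' < card V" unfolding V'_def using uv finV by (intro psubset_card_mono) auto
    moreover have "H' \<subseteq> complete_edges V'"
      using H by (auto simp: H'_def V'_def complete_edges_eq)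
    ultimately obtain A B where AB: "bisection V' A B"
      and IH: "card H' + card (M - D) \<le> 2 * card (cut H' A B)"
      using less.hyps[of V' H' "M - D"] M' finV less.prems(4)
      by (metis V'_def finite_Diff pairwise_subset Diff_subset)
    let ?X1 = "cut X (insert u A) (insert v B)" and ?X2 = "cut X (insert v A) (insert u B)"
    have bis: "bisection V (insert u A) (insert v B)" "bisection V (insert v A) (insert u B)"
      using bisection_insert_pair[of V u v A B] bisection_insert_pair[of V v u A B] AB uv finV
      by (simp_all add: V'_def insert_commute)
    have lower: "card (cut H' A B) + card (cut X (insert x A) (insert y B)) + card D
        \<le> card (cut H (insert x A) (insert y B))" if "{x, y} = {u, v}" for x y
    proof -
      let ?c = "\<lambda>F. cut F (insert x A) (insert y B)"
      have "?c D = D" using that by (auto simp: cut_def D_def)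
      then have eq: "?c H = ?c H' \<union> ?c X \<union> D" using part(1) cut_Un by metis
      have "?c H' \<inter> ?c X = {}" "(?c H' \<union> ?c X) \<inter> D = {}"
        using part(2,3) cut_subset[of H' "insert x A" "insert y B"]
          cut_subset[of X "insert x A" "insert y B"] by blast+
      then have "card (?c H) = card (?c H') + card (?c X) + card D"
        using eq fin by (metis card_Un_disjoint cut_subset finite_Un finite_subset)
      moreover have "card (cut H' A B) \<le> card (?c H')"
        using fin by (intro card_mono cut_mono) (auto intro: finite_subset[OF cut_subset])
      ultimately show ?thesis by linarith
    qed
    have "X \<subseteq> ?X1 \<union> ?X2"
    proof
      fix e assume e: "e \<in> X"
      then obtain a b where ab: "e = {a, b}" "a \<in> V" "b \<in> V" "a \<noteq> b"
        using H part(1) unfolding complete_edges_def by blast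
      have "e \<noteq> {u, v}" "u \<in> e \<or> v \<in> e" using e by (auto simp: X_def D_def H'_def)
      then obtain x y where xy: "e = {x, y}" "x \<in> {u, v}" "y \<in> V'"
        using ab by (auto simp: V'_def insert_commute)
      moreover have "y \<in> A \<or> y \<in> B" using xy(3) AB by (auto simp: bisection_def)
      ultimately show "e \<in> ?X1 \<union> ?X2" using e by (auto simp: cut_def)
    qed
    then have "card X \<le> card ?X1 + card ?X2"
      using fin by (meson card_Un_le card_mono cut_subset finite_Un finite_subset le_trans)
    then have "card X \<le> 2 * card ?X1 \<or> card X \<le> 2 * card ?X2" by linarith
    then show ?thesis
    proof
      assume "card X \<le> 2 * card ?X1"
      then have "card H + card M \<le> 2 * card (cut H (insert u A) (insert v B))"
        using lower[of u v] cardH IH \<open>card M \<le> card (M - D) + card D\<close> by simp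
      then show ?thesis using bis by blast
    next
      assume "card X \<le> 2 * card ?X2"
      then have "card H + card M \<le> 2 * card (cut H (insert v A) (insert u B))"
        using lower[of v u] cardH IH \<open>card M \<le> card (M - D) + card D\<close>
        by (simp add: insert_commute)
      then show ?thesis using bis by blast
    qed
  qed
qed

lemma intersecting_edges_star_or_triangle:
  assumes H: "H \<subseteq> complete_edges V" "H \<noteq> {}"
    and meet: "\<And>e f. e \<in> H \<Longrightarrow> f \<in> H \<Longrightarrow> e \<inter> f \<noteq> {}"
  obtains (star) c where "c \<in> V" "\<And>e. e \<in> H \<Longrightarrow> c \<in> e"
  | (triangle) a b c where "a \<in> V" "b \<in> V" "c \<in> V" "a \<noteq> b" "b \<noteq> c" "a \<noteq> c"
      "H = {{a, b}, {b, c}, {a, c}}"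
proof (cases "\<exists>c\<in>V. \<forall>e\<in>H. c \<in> e")
  case True
  then show ?thesis using star by blast
next
  case False
  have edge: "\<exists>a\<in>V. \<exists>b\<in>V. e = {a, b} \<and> a \<noteq> b" if "e \<in> H" for e
    using that H(1) unfolding complete_edges_def by blast
  obtain a b where ab: "{a, b} \<in> H" "a \<in> V" "b \<in> V" "a \<noteq> b" using H(2) edge by blast
  obtain f where f: "f \<in> H" "a \<notin> f" using False ab by blast
  obtain c where c: "f = {b, c}" "c \<in> V" "b \<noteq> c" "a \<noteq> c"
    using edge[OF f(1)] meet[OF ab(1) f(1)] f(2) by (auto simp: insert_commute)
  obtain g where g: "g \<in> H" "b \<notin> g" using False ab by blast
  have g_eq: "g = {a, c}"
    using edge[OF g(1)] meet[OF ab(1) g(1)] meet[OF f(1) g(1)] g(2) c by auto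
  have "h \<in> {{a, b}, {b, c}, {a, c}}" if "h \<in> H" for h
    using edge[OF that] meet[OF that ab(1)] meet[OF that f(1)] meet[OF that g(1)] c g_eq ab
    by auto
  then have "H = {{a, b}, {b, c}, {a, c}}" using ab f g c g_eq by blast
  then show ?thesis using triangle ab c by blast
qed

lemma bisection_cutting_star:
  assumes "finite V" "c \<in> V" "H \<subseteq> complete_edges V" "\<And>e. e \<in> H \<Longrightarrow> c \<in> e"
  shows "\<exists>A B. bisection V A B \<and> min (card H) (card V - card V div 2) \<le> card (cut H A B)"
proof -
  define N where "N = {x. {c, x} \<in> H}"
  define k where "k = card V - card V div 2"
  have N: "N \<subseteq> V - {c}" using assms(3) unfolding N_def
    by (auto dest!: subsetD simp: complete_edges_def doubleton_eq_iff)
  have "H = (\<lambda>x. {c, x}) ` N"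
  proof
    show "H \<subseteq> (\<lambda>x. {c, x}) ` N"
    proof
      fix e assume e: "e \<in> H"
      then obtain x where "e = {c, x}" using assms(3,4) unfolding complete_edges_def by blast
      then show "e \<in> (\<lambda>x. {c, x}) ` N" using e by (auto simp: N_def)
    qed
  qed (auto simp: N_def)
  moreover have inj: "inj_on (\<lambda>x. {c, x}) S" for S by (auto simp: inj_on_def doubleton_eq_iff)
  ultimately have cardH: "card H = card N" by (simp add: card_image)
  have pos: "0 < card V" using assms(1,2) by (auto simp: card_gt_0_iff)
  obtain B where B: "B \<subseteq> V - {c}" "card B = (if card V = 1 then 0 else k)"
      "min (card N) (card B) \<le> card (N \<inter> B)"
  proof (cases "card V = 1")
    case True
    show ?thesis by (rule that[of "{}"]) (use True in auto)
  next
    case False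
    then have k: "k \<le> card (V - {c})" using assms(1,2) pos by (simp add: k_def)
    show ?thesis
    proof (cases "card N \<le> k")
      case True
      then obtain B where "N \<subseteq> B" "B \<subseteq> V - {c}" "card B = k"
        using exists_subset_between[OF True k N] assms(1) by auto
      then show ?thesis using False by (intro that[of B]) (auto simp: Int_absorb2)
    next
      case False
      then obtain B where "B \<subseteq> N" "card B = k"
        using obtain_subset_with_card_n[of k N] by auto
      then show ?thesis using \<open>card V \<noteq> 1\<close> N by (intro that[of B]) (auto simp: Int_absorb1)
    qed
  qed
  have finB: "finite B" using B(1) assms(1) finite_subset by blast
  have "card (V - B) = card V - card B"
    using B(1) finB by (intro card_Diff_subset) auto
  then have "bisection V (V - B) B"
    using B(1,2) pos by (auto simp: bisection_def k_def)
  moreover have "(\<lambda>x. {c, x}) ` (N \<inter> B) \<subseteq> cut H (V - B) B"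
    using B(1) assms(2) by (auto simp: cut_def N_def)
  then have "card (N \<inter> B) \<le> card (cut H (V - B) B)"
    using card_mono[of "cut H (V - B) B"] card_image[OF inj, of "N \<inter> B"]
      finite_subset[OF cut_subset] finite_subset[OF assms(3) finite_complete_edges[OF assms(1)]]
    by metis
  moreover have "card N = 0" if "card V = 1"
    using that N assms(2) by (auto simp: card_1_singleton_iff)
  ultimately show ?thesis using B(2,3) cardH unfolding k_def
    by (intro exI[of _ "V - B"] exI[of _ B]) (auto split: if_splits)
qed

lemma connected_graph_neighbour:
  assumes "connected_graph V E" "c \<in> V" "2 \<le> card V"
  obtains x where "{c, x} \<in> E"
proof -
  have "V \<noteq> {c}" using assms(3) by auto
  then obtain d where "d \<in> V" "d \<noteq> c" using assms(2) by blast
  then have "(c, d) \<in> {(x, y). {x, y} \<in> E}\<^sup>*" "c \<noteq> d"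
    using assms(1,2) by (auto simp: connected_graph_def)
  then show ?thesis using that by (auto elim: converse_rtranclE)
qed

lemma bisection_cutting_complement:
  assumes "finite V" "4 \<le> card V" "connected_graph V E" "E \<subseteq> complete_edges V"
    and H: "H = complete_edges V - E"
    and not: "\<not> is_complete V E" "\<not> is_complete_minus_edge V E" "\<not> is_complete_minus_triangle V E"
  shows "\<exists>A B. bisection V A B \<and> (card H + 1) div 2 < card (cut H A B)"
proof -
  have HK: "H \<subseteq> complete_edges V" and E: "E = complete_edges V - H" using H assms(4) by auto
  have "H \<noteq> {}" using not(1) E by (auto simp: is_complete_def)
  then obtain e where e: "e \<in> H" by blast
  have "card H \<noteq> 1"
  proof
    assume "card H = 1"
    then show False using not(2) E HK by (auto simp: card_1_singleton_iff is_complete_minus_edge_def)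
  qed
  show ?thesis
  proof (cases "even (card H)")
    case True
    obtain A B where "bisection V A B" "card H + card {e} \<le> 2 * card (cut H A B)"
      using bisection_cutting_matching[OF assms(1) HK, of "{e}"] e by (auto simp: pairwise_def)
    then have "(card H + 1) div 2 < card (cut H A B)" using True by (auto elim!: evenE)
    then show ?thesis using \<open>bisection V A B\<close> by blast
  next
    case odd: False
    with \<open>card H \<noteq> 1\<close> have H3: "3 \<le> card H" by presburger
    show ?thesis
    proof (cases "\<exists>e\<in>H. \<exists>f\<in>H. e \<inter> f = {}")
      case True
      then obtain e f where ef: "e \<in> H" "f \<in> H" "e \<inter> f = {}" by blast
      then have "e \<noteq> f" using HK by (auto simp: complete_edges_def)
      then have "pairwise disjnt {e, f}" "card {e, f} = 2"
        using ef by (auto simp: pairwise_def disjnt_def)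
      then obtain A B where "bisection V A B" "card H + 2 \<le> 2 * card (cut H A B)"
        using bisection_cutting_matching[OF assms(1) HK, of "{e, f}"] ef by auto
      then have "(card H + 1) div 2 < card (cut H A B)" using odd by presburger
      then show ?thesis using \<open>bisection V A B\<close> by blast
    next
      case False
      then have meet: "\<And>e f. e \<in> H \<Longrightarrow> f \<in> H \<Longrightarrow> e \<inter> f \<noteq> {}" by blast
      show ?thesis
      proof (rule intersecting_edges_star_or_triangle[OF HK \<open>H \<noteq> {}\<close> meet])
        fix c assume c: "c \<in> V" "\<And>e. e \<in> H \<Longrightarrow> c \<in> e"
        obtain x where x: "{c, x} \<in> E"
          using connected_graph_neighbour[OF assms(3) c(1)] assms(2) by auto
        then have "{c, x} \<in> complete_edges V" using assms(4) by (rule subsetD[rotated])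
        then have cx: "x \<in> V" "x \<noteq> c" by (auto simp: complete_edges_iff)
        have "H \<subseteq> (\<lambda>y. {c, y}) ` (V - {c, x})"
        proof
          fix h assume h: "h \<in> H"
          then obtain y where y: "h = {c, y}" "y \<in> V" "y \<noteq> c"
            using HK c(2)[OF h] unfolding complete_edges_def by blast
          moreover have "y \<noteq> x" using x h y H by blast
          ultimately show "h \<in> (\<lambda>y. {c, y}) ` (V - {c, x})" by blast
        qed
        then have "card H \<le> card (V - {c, x})"
          using assms(1) by (meson finite_Diff surj_card_le)
        also have "\<dots> = card V - 2" using cx c(1) assms(1) by (subst card_Diff_subset) auto
        finally have "card H + 2 \<le> card V" using assms(2) by linarith
        moreover obtain k where "card H = 2 * k + 1" using odd by (auto elim: oddE)
        ultimately have "(card H + 1) div 2 < min (card H) (card V - card V div 2)"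
          using H3 by simp
        then show ?thesis
          using bisection_cutting_star[OF assms(1) c(1) HK c(2)] by (meson less_le_trans)
      next
        fix a b c assume "a \<in> V" "b \<in> V" "c \<in> V" "a \<noteq> b" "b \<noteq> c" "a \<noteq> c"
          "H = {{a, b}, {b, c}, {a, c}}"
        then have "is_complete_minus_triangle V E"
          using E unfolding is_complete_minus_triangle_def by blast
        then show ?thesis using not by blast
      qed
    qed
  qed
qed

lemma card_cut_complement_le:
  assumes "bisection V A B" and H: "H = complete_edges V - E"
    and "is_complete V E \<or> is_complete_minus_edge V E \<or> is_complete_minus_triangle V E"
  shows "card (cut H A B) \<le> (card H + 1) div 2"
  using assms(3)
proof (elim disjE)
  assume "is_complete V E"
  then show ?thesis using H by (auto simp: is_complete_def cut_def)
next
  assume "is_complete_minus_edge V E"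
  then obtain e where "e \<in> complete_edges V" "E = complete_edges V - {e}"
    unfolding is_complete_minus_edge_def by blast
  then have "H = {e}" using H by blast
  then show ?thesis using card_mono[OF _ cut_subset, of H A B] by simp
next
  assume "is_complete_minus_triangle V E"
  then obtain a b c where abc: "a \<in> V" "b \<in> V" "c \<in> V" "a \<noteq> b" "b \<noteq> c" "a \<noteq> c"
    and "E = complete_edges V - {{a, b}, {b, c}, {a, c}}"
    unfolding is_complete_minus_triangle_def by blast
  then have H3: "H = {{a, b}, {b, c}, {a, c}}" using H by (auto simp: complete_edges_iff)
  have "cut H A B \<noteq> H"
  proof
    assume "cut H A B = H"
    then have "\<And>e. e \<in> H \<Longrightarrow> \<exists>u\<in>A. \<exists>v\<in>B. e = {u, v}" by (auto simp: cut_def)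
    from this[of "{a, b}"] this[of "{b, c}"] this[of "{a, c}"] show False
      using H3 assms(1) by (auto simp: bisection_def doubleton_eq_iff)
  qed
  then have "cut H A B \<subset> H" using cut_subset by blast
  then have "card (cut H A B) < card H" using H3 by (intro psubset_card_mono) auto
  moreover have "card H = 3" using H3 abc by (auto simp: doubleton_eq_iff card_insert_if)
  ultimately show ?thesis by simp
qed

lemma floor_bound_eq:
  fixes m n e :: nat
  assumes "2 * (m + e) = n * (n - 1)"
  shows "\<lfloor>real m / 2 + real n / 4\<rfloor> = int (n\<^sup>2 div 4) - int ((e + 1) div 2)"
proof -
  define q where "q = n\<^sup>2 div 4"
  have "n\<^sup>2 = 4 * q \<or> n\<^sup>2 = 4 * q + 1"
  proof (cases "even n")
    case True
    then show ?thesis by (auto elim!: evenE simp: q_def power2_eq_square)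
  next
    case False
    then obtain k where "n = 2 * k + 1" by (auto elim: oddE)
    then have "n\<^sup>2 = 4 * (k * k + k) + 1" by (simp add: power2_eq_square algebra_simps)
    then have "q = k * k + k"
      unfolding q_def by (intro div_nat_eqI) simp_all
    then show ?thesis using \<open>n\<^sup>2 = 4 * (k * k + k) + 1\<close> by simp
  qed
  moreover have "2 * m + n + 2 * e = n\<^sup>2"
    using assms by (cases n) (auto simp: power2_eq_square)
  ultimately have "(2 * m + n) + 2 * e = 4 * q \<or> (2 * m + n) + 2 * e = 4 * q + 1" by simp
  moreover define c where "c = (e + 1) div 2"
  moreover have "2 * c = e \<or> 2 * c = e + 1" unfolding c_def by presburger
  ultimately have "int (2 * m + n) div 4 = int q - int c"
    by (intro int_div_pos_eq[where r = "int (2 * m + n) - 4 * (int q - int c)"]) auto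
  moreover have "real m / 2 + real n / 4 = real_of_int (int (2 * m + n)) / real_of_int 4" by simp
  then have "\<lfloor>real m / 2 + real n / 4\<rfloor> = int (2 * m + n) div 4"
    by (simp only: floor_divide_of_int_eq)
  ultimately show ?thesis unfolding q_def c_def by simp
qed

theorem theorem2:
  fixes V :: "'a set" and E :: "'a set set" and m n :: nat
  assumes "finite_simple_graph V E"
    and "connected_graph V E"
    and "card E = m"
    and "card V = n"
    and "n \<ge> 4"
  shows "int (rna_number V E) \<le> \<lfloor>real m / 2 + real n / 4\<rfloor> \<and>
    (int (rna_number V E) = \<lfloor>real m / 2 + real n / 4\<rfloor> \<longleftrightarrow>
       is_complete V E \<or> is_complete_minus_edge V E \<or> is_complete_minus_triangle V E)"
proof -
  have V: "finite V" and E: "E \<subseteq> complete_edges V"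
    using assms(1) by (auto simp: finite_simple_graph_def)
  define H where "H = complete_edges V - E"
  have "card H = card (complete_edges V) - m" "m \<le> card (complete_edges V)"
    using E finite_complete_edges[OF V] assms(3)
    by (auto simp: H_def card_Diff_subset finite_subset card_mono)
  then have "2 * (m + card H) = n * (n - 1)" using card_complete_edges[OF V] assms(4) by simp
  note bound = floor_bound_eq[OF this]
  have sum: "card (cut E A B) + card (cut H A B) = n\<^sup>2 div 4" if "bisection V A B" for A B
    using card_cut_complement[OF that V E] assms(4) by (simp add: H_def)
  obtain A B where AB: "bisection V A B" "rna_number V E = card (cut E A B)"
    using rna_number_attained[OF V] .
  obtain A' B' where AB': "bisection V A' B'" "card H \<le> 2 * card (cut H A' B')"
    using bisection_cutting_matching[OF V, of H "{}"] by (auto simp: H_def)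
  have "(card H + 1) div 2 \<le> card (cut H A' B')" using AB'(2) by linarith
  then have le: "int (rna_number V E) \<le> \<lfloor>real m / 2 + real n / 4\<rfloor>"
    using rna_number_le_cut[OF AB'(1), of E] sum[OF AB'(1)] bound by linarith
  show ?thesis
  proof (cases "is_complete V E \<or> is_complete_minus_edge V E \<or> is_complete_minus_triangle V E")
    case True
    then have "card (cut H A B) \<le> (card H + 1) div 2"
      using card_cut_complement_le[OF AB(1) H_def] by blast
    then show ?thesis using le True AB(2) sum[OF AB(1)] bound by linarith
  next
    case False
    then obtain C D where CD: "bisection V C D" "(card H + 1) div 2 < card (cut H C D)"
      using bisection_cutting_complement[OF V _ assms(2) E H_def] assms(4,5) by blast
    then show ?thesis
      using le False rna_number_le_cut[OF CD(1), of E] sum[OF CD(1)] bound by linarith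
  qed
qed

end
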